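(* For fixed integers $k\geq\ell\geq 1$, and for all integers $n\geq 1$, $$f(k,n,\ell)\leq n^\ell+O(n^{\ell-1}).$$ That is, for all integers $k\geq\ell\geq1$ there is a constant $C$ (depending only on $k$ and $\ell$) such that $f(k,n,\ell)\leq n^\ell+C\,n^{\ell-1}$ for every integer $n\geq 1$.
   Context: $[n]:=\{1,2,\dots,n\}$. $G(k,n)$ is the complete $k$-partite graph with $n$ vertices in each colour class: its vertex set is $[k]\times[n]$, and $(c,u)$ is adjacent to $(d,v)$ if and only if $c\neq d$. $K_m$ is the complete graph on $m$ vertices. For integers $k\geq\ell\geq1$ and $n\geq1$, $f(k,n,\ell)$ is the minimum number of copies of $K_k$ in $G(k,n)$ such that each $K_\ell$ subgraph of $G(k,n)$ appears in (is a subgraph of) at least one of these copies. *)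

theory Defs
  imports Complex_Main "Graph_Theory.Kuratowski"
begin

text \<open>An undirected simple graph is a symmetric, loop-free digraph without multiple arcs, i.e.
  the locale \<open>graph\<close>; each edge is the pair of its two opposite arcs.\<close>

definition complete_multipartite :: "nat \<Rightarrow> nat \<Rightarrow> (nat \<times> nat) pair_pre_digraph" where
  "complete_multipartite k n =
    \<lparr> pverts = {1..k} \<times> {1..n},
      parcs = {((c, u), (d, v)) | c u d v.
                 c \<in> {1..k} \<and> u \<in> {1..n} \<and> d \<in> {1..k} \<and> v \<in> {1..n} \<and> c \<noteq> d} \<rparr>"

definition complete_subgraphs :: "nat \<Rightarrow> 'a pair_pre_digraph \<Rightarrow> 'a pair_pre_digraph set" where
  "complete_subgraphs m G =
    {H. subgraph (with_proj H) (with_proj G) \<and> K\<^bsub>m\<^esub> (with_proj H)}"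

definition is_clique_cover ::
    "nat \<Rightarrow> nat \<Rightarrow> nat \<Rightarrow> (nat \<times> nat) pair_pre_digraph set \<Rightarrow> bool" where
  "is_clique_cover k n l F \<longleftrightarrow>
    F \<subseteq> complete_subgraphs k (complete_multipartite k n) \<and>
    (\<forall>T \<in> complete_subgraphs l (complete_multipartite k n).
       \<exists>H \<in> F. subgraph (with_proj T) (with_proj H))"

definition clique_cover_number :: "nat \<Rightarrow> nat \<Rightarrow> nat \<Rightarrow> nat" where
  "clique_cover_number k n l = (LEAST m. \<exists>F. finite F \<and> is_clique_cover k n l F \<and> card F = m)"

lemma graph_complete_multipartite: "graph (with_proj (complete_multipartite k n))"
proof -
  have "finite (parcs (complete_multipartite k n))"
    by (rule finite_subset[of _ "({1..k} \<times> {1..n}) \<times> ({1..k} \<times> {1..n})"])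
       (auto simp: complete_multipartite_def)
  then show ?thesis
    by unfold_locales
       (auto simp: complete_multipartite_def arc_to_ends_def symmetric_conv)
qed

lemma complete_subgraphs_eq:
  assumes "graph (with_proj G)"
  shows "complete_subgraphs m G =
    (\<lambda>S. \<lparr> pverts = S, parcs = {(x, y). x \<in> S \<and> y \<in> S \<and> x \<noteq> y} \<rparr>) `
      {S. S \<subseteq> pverts G \<and> card S = m \<and> (\<forall>x\<in>S. \<forall>y\<in>S. x \<noteq> y \<longrightarrow> (x, y) \<in> parcs G)}"
    (is "?L = ?R")
proof
  show "?L \<subseteq> ?R"
  proof
    fix H assume H: "H \<in> ?L"
    then have "H = \<lparr> pverts = pverts H, parcs = {(x, y). x \<in> pverts H \<and> y \<in> pverts H \<and> x \<noteq> y} \<rparr>"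
      by (auto simp: complete_subgraphs_def complete_digraph_def)
    moreover have "pverts H \<subseteq> pverts G" "card (pverts H) = m"
      "\<forall>x\<in>pverts H. \<forall>y\<in>pverts H. x \<noteq> y \<longrightarrow> (x, y) \<in> parcs G"
      using H by (auto simp: complete_subgraphs_def complete_digraph_def subgraph_def)
    ultimately show "H \<in> ?R" by blast
  qed
next
  interpret G: graph "with_proj G" by fact
  show "?R \<subseteq> ?L"
  proof
    fix H assume "H \<in> ?R"
    then obtain S where S: "S \<subseteq> pverts G" "card S = m"
      "\<forall>x\<in>S. \<forall>y\<in>S. x \<noteq> y \<longrightarrow> (x, y) \<in> parcs G"
      and H: "H = \<lparr> pverts = S, parcs = {(x, y). x \<in> S \<and> y \<in> S \<and> x \<noteq> y} \<rparr>" by blast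
    have fin: "finite S" using S(1) G.finite_verts finite_subset by fastforce
    have fin2: "finite {(x, y). x \<in> S \<and> y \<in> S \<and> x \<noteq> y}"
      by (rule finite_subset[of _ "S \<times> S"]) (use fin in auto)
    have g: "graph (with_proj H)"
      by unfold_locales (use fin fin2 in \<open>auto simp: H arc_to_ends_def symmetric_conv\<close>)
    then have "wf_digraph (with_proj H)"
      by (simp add: graph_def digraph_def fin_digraph_def)
    then show "H \<in> ?L" using S g G.wf_digraph
      by (auto simp: complete_subgraphs_def complete_digraph_def subgraph_def H compatible_def)
  qed
qed

lemma is_clique_cover_all:
  assumes "1 \<le> n" "l \<le> k"
  shows "finite (complete_subgraphs k (complete_multipartite k n))"
    and "is_clique_cover k n l (complete_subgraphs k (complete_multipartite k n))"
proof -
  let ?G = "complete_multipartite k n"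
  let ?c = "\<lambda>S::(nat \<times> nat) set. \<lparr> pverts = S, parcs = {(x, y). x \<in> S \<and> y \<in> S \<and> x \<noteq> y} \<rparr>"
  note E = complete_subgraphs_eq[OF graph_complete_multipartite]
  have fin: "finite (pverts ?G)" by (auto simp: complete_multipartite_def)
  show "finite (complete_subgraphs k ?G)"
    unfolding E by (rule finite_imageI, rule finite_subset[of _ "Pow (pverts ?G)"]) (use fin in auto)
  have "\<exists>H \<in> complete_subgraphs k ?G. subgraph (with_proj T) (with_proj H)"
    if T: "T \<in> complete_subgraphs l ?G" for T
  proof -
    obtain S where S: "S \<subseteq> pverts ?G" "\<forall>x\<in>S. \<forall>y\<in>S. x \<noteq> y \<longrightarrow> (x, y) \<in> parcs ?G"
      and TS: "T = ?c S" using T unfolding E by blast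
    define U where "U = S \<union> ({1..k} - fst ` S) \<times> {1}"
    have inj: "inj_on fst U" using S(2)
      by (auto simp: inj_on_def U_def complete_multipartite_def) (metis fst_conv image_eqI snd_conv)+
    have "fst ` S \<subseteq> {1..k}" using S(1)
      by (auto simp: complete_multipartite_def)
    then have im: "fst ` U = {1..k}"
      by (auto simp: U_def image_Un)
    have "card U = k" using card_image[OF inj] im by simp
    moreover have Usub: "U \<subseteq> pverts ?G" using S(1) assms by (auto simp: U_def complete_multipartite_def)
    moreover have "\<forall>x\<in>U. \<forall>y\<in>U. x \<noteq> y \<longrightarrow> (x, y) \<in> parcs ?G"
    proof (intro ballI impI)
      fix x y assume "x \<in> U" "y \<in> U" "x \<noteq> y"
      then have "fst x \<noteq> fst y" "x \<in> pverts ?G" "y \<in> pverts ?G"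
        using inj Usub by (auto simp: inj_on_def)
      then show "(x, y) \<in> parcs ?G" by (cases x; cases y) (auto simp: complete_multipartite_def)
    qed
    ultimately have "?c U \<in> complete_subgraphs k ?G" unfolding E by blast
    moreover have "subgraph (with_proj T) (with_proj (?c U))"
      by (auto simp: subgraph_def TS U_def compatible_def intro!: wf_digraph.intro)
    ultimately show ?thesis by blast
  qed
  then show "is_clique_cover k n l (complete_subgraphs k ?G)"
    by (simp add: is_clique_cover_def)
qed

lemma clique_cover_number_attained:
  assumes "1 \<le> n" "l \<le> k"
  shows "\<exists>F. finite F \<and> is_clique_cover k n l F \<and> card F = clique_cover_number k n l"
  unfolding clique_cover_number_def
  by (rule LeastI_ex) (use is_clique_cover_all[OF assms] in blast)

end

theory Submission
  imports Defs "HOL-Number_Theory.Cong" "HOL-Computational_Algebra.Polynomial" "HOL-Library.FuncSet"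
begin

text \<open>A copy of \<open>K\<^sub>k\<close> in \<open>G(k,n)\<close> picks one vertex of each colour, so it is the graph of a function
  \<open>[k] \<rightarrow> [n]\<close>, and a copy of \<open>K\<^sub>l\<close> is a function on an \<open>l\<close>-element set of colours.  A clique cover is
  therefore a covering array of strength \<open>l\<close>: a family of functions that realises every assignment
  on every \<open>l\<close> colours.

  For a suitable modulus \<open>m\<close>, the polynomial functions of degree less than \<open>l\<close> over the ring of
  integers modulo \<open>m\<close> form such a family of size at most \<open>m ^ l\<close>.  Interpolation at \<open>l\<close> of the points
  \<open>1, \<dots>, k\<close> only divides by differences of these points, so \<open>m\<close> need not be prime: it is enough that
  all these differences are units, and they are as soon as \<open>m \<equiv> 1\<close> modulo \<open>k!\<close>.  Such moduli have
  bounded gaps, in contrast to primes, and this is what gives the error term \<open>O(n ^ (l - 1))\<close>: take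
  \<open>m\<close> with \<open>n < m \<le> n + k! + 1\<close> (\<open>modulus_with_unit_differences\<close>), take the polynomial functions
  modulo \<open>m\<close> (\<open>interpolation_mod\<close>), and change every value outside \<open>[n]\<close> to \<open>1\<close>
  (\<open>covering_array_exists\<close>).  Assignments with values in \<open>[n]\<close> stay covered, and
  \<open>m ^ l \<le> (n + k! + 1) ^ l\<close>.\<close>

definition covering_array :: "nat \<Rightarrow> nat \<Rightarrow> nat \<Rightarrow> (nat \<Rightarrow> nat) set \<Rightarrow> bool" where
  "covering_array k n l R \<longleftrightarrow>
    R \<subseteq> {1..k} \<rightarrow> {1..n} \<and>
    (\<forall>S \<subseteq> {1..k}. card S = l \<longrightarrow>
      (\<forall>y \<in> S \<rightarrow> {1..n}. \<exists>r \<in> R. \<forall>c \<in> S. r c = y c))"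

text \<open>Each row \<open>r\<close> becomes the clique on its graph \<open>{(c, r c)}\<close>.  Distinct vertices of a clique have
  distinct colours, so the vertex set of a copy of \<open>K\<^sub>l\<close> is the graph of a function on the set of its
  colours.\<close>

lemma clique_cover_number_le_covering_array:
  assumes R: "covering_array k n l R" and fin: "finite R"
  shows "clique_cover_number k n l \<le> card R"
proof -
  let ?G = "complete_multipartite k n"
  let ?c = "\<lambda>S::(nat \<times> nat) set. \<lparr> pverts = S, parcs = {(x, y). x \<in> S \<and> y \<in> S \<and> x \<noteq> y} \<rparr>"
  let ?F = "(\<lambda>r. ?c ((\<lambda>c. (c, r c)) ` {1..k})) ` R"
  note E = complete_subgraphs_eq[OF graph_complete_multipartite]
  have "?F \<subseteq> complete_subgraphs k ?G"
  proof
    fix H assume "H \<in> ?F"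
    then obtain r where r: "r \<in> R" and H: "H = ?c ((\<lambda>c. (c, r c)) ` {1..k})" by blast
    let ?S = "(\<lambda>c. (c, r c)) ` {1..k}"
    have rng: "r c \<in> {1..n}" if "c \<in> {1..k}" for c
      using R r that by (auto simp only: covering_array_def)
    have "card ?S = k" by (subst card_image) (auto simp: inj_on_def)
    moreover have "?S \<subseteq> pverts ?G" using rng by (auto simp: complete_multipartite_def)
    moreover have "\<forall>x\<in>?S. \<forall>y\<in>?S. x \<noteq> y \<longrightarrow> (x, y) \<in> parcs ?G"
      using rng by (auto simp: complete_multipartite_def)
    ultimately show "H \<in> complete_subgraphs k ?G" unfolding E H by blast
  qed
  moreover have "\<exists>H \<in> ?F. subgraph (with_proj T) (with_proj H)"
    if T: "T \<in> complete_subgraphs l ?G" for T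
  proof -
    obtain V where V: "V \<subseteq> pverts ?G" "card V = l" "\<forall>x\<in>V. \<forall>y\<in>V. x \<noteq> y \<longrightarrow> (x, y) \<in> parcs ?G"
      and TV: "T = ?c V" using T unfolding E by blast
    have inj: "inj_on fst V"
      using V(3) by (fastforce simp: inj_on_def complete_multipartite_def)
    define y where "y = (\<lambda>c. snd (inv_into V fst c))"
    have y: "y (fst v) = snd v" if "v \<in> V" for v
      using inj that by (simp add: y_def)
    have "fst ` V \<subseteq> {1..k}" using V(1) by (auto simp: complete_multipartite_def)
    moreover have "card (fst ` V) = l" using card_image[OF inj] V(2) by simp
    moreover have "y \<in> fst ` V \<rightarrow> {1..n}"
      using V(1) y by (fastforce simp: complete_multipartite_def)
    ultimately obtain r where r: "r \<in> R" "\<forall>c \<in> fst ` V. r c = y c"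
      using R unfolding covering_array_def by blast
    let ?S = "(\<lambda>c. (c, r c)) ` {1..k}"
    have sub: "V \<subseteq> ?S"
    proof
      fix v assume v: "v \<in> V"
      then have "v = (fst v, r (fst v))" using r(2) y by simp
      moreover have "fst v \<in> {1..k}" using v V(1) by (auto simp: complete_multipartite_def)
      ultimately show "v \<in> ?S" by blast
    qed
    have "subgraph (with_proj T) (with_proj (?c ?S))"
      using sub by (auto simp: subgraph_def TV compatible_def intro!: wf_digraph.intro)
    then show ?thesis using r(1) by blast
  qed
  ultimately have "is_clique_cover k n l ?F" by (simp add: is_clique_cover_def)
  then have "clique_cover_number k n l \<le> card ?F"
    unfolding clique_cover_number_def using fin by (intro Least_le) blast
  also have "\<dots> \<le> card R" using fin by (rule card_image_le)
  finally show ?thesis .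
qed

text \<open>Newton interpolation: to pass from \<open>S\<close> to one more point \<open>s\<close>, add a multiple of the monic
  polynomial vanishing on \<open>S\<close>.  Its value at \<open>s\<close> is a product of differences of points, hence
  invertible modulo \<open>m\<close>, so the multiple can be chosen to correct the value at \<open>s\<close>.\<close>

lemma interpolation_mod:
  fixes S :: "int set" and m :: int
  assumes "finite S" and "\<And>x y. x \<in> S \<Longrightarrow> y \<in> S \<Longrightarrow> x \<noteq> y \<Longrightarrow> coprime (x - y) m"
  shows "\<exists>p :: int poly. (\<forall>i \<ge> card S. coeff p i = 0) \<and> (\<forall>x \<in> S. [poly p x = y x] (mod m))"
  using assms
proof (induction S rule: finite_induct)
  case empty
  show ?case by (rule exI[of _ 0]) simp
next
  case (insert s S)
  obtain p where p: "\<forall>i \<ge> card S. coeff p i = 0" "\<forall>x \<in> S. [poly p x = y x] (mod m)"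
    using insert.IH insert.prems by (metis insertCI)
  define q :: "int poly" where "q = (\<Prod>x\<in>S. [:- x, 1:])"
  have deg: "degree q = card S"
    unfolding q_def by (subst degree_prod_eq_sum_degree) auto
  have q0: "poly q x = 0" if "x \<in> S" for x
    using that insert.hyps by (auto simp: q_def poly_prod)
  have "poly q s = (\<Prod>x\<in>S. s - x)" by (simp add: q_def poly_prod)
  moreover have "coprime (\<Prod>x\<in>S. s - x) m"
    using insert.hyps insert.prems by (intro prod_coprime_left) auto
  ultimately obtain d where d: "[poly q s * d = 1] (mod m)"
    using cong_solve_coprime_int by metis
  define p' where "p' = p + smult (d * (y s - poly p s)) q"
  have "coeff p' i = 0" if "i \<ge> card (insert s S)" for i
    using that p(1) insert.hyps deg by (simp add: p'_def coeff_eq_0)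
  moreover have "[poly p' x = y x] (mod m)" if "x \<in> S" for x
    using that p(2) q0 by (simp add: p'_def)
  moreover have "[poly p' s = y s] (mod m)"
  proof -
    have "[poly p s + (poly q s * d) * (y s - poly p s) = poly p s + 1 * (y s - poly p s)] (mod m)"
      by (intro cong_add cong_mult cong_refl d)
    moreover have "poly p' s = poly p s + (poly q s * d) * (y s - poly p s)"
      by (simp add: p'_def algebra_simps)
    ultimately show ?thesis by simp
  qed
  ultimately show ?case by (intro exI[of _ p']) auto
qed

text \<open>The rows are indexed by the coefficient vectors modulo \<open>m\<close>.  As \<open>n < m\<close>, an assignment with
  values in \<open>{1..n}\<close> is determined by its residues, so it survives the replacement of all other values
  by \<open>1\<close>.\<close>

lemma covering_array_exists:
  assumes n: "1 \<le> n" "n < m"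
    and cop: "\<And>x y. x \<in> {1..k} \<Longrightarrow> y \<in> {1..k} \<Longrightarrow> x \<noteq> y \<Longrightarrow> coprime (int x - int y) (int m)"
  shows "\<exists>R. finite R \<and> covering_array k n l R \<and> card R \<le> m ^ l"
proof -
  define A where "A = {..<l} \<rightarrow>\<^sub>E {0..<int m}"
  define val where "val = (\<lambda>a c. nat ((\<Sum>i<l. a i * int c ^ i) mod int m))"
  define row where "row = (\<lambda>a c. if val a c \<in> {1..n} then val a c else 1)"
  have finA: "finite A" unfolding A_def by (intro finite_PiE) auto
  have "card A = m ^ l" by (simp add: A_def card_PiE)
  then have card: "card (row ` A) \<le> m ^ l" using card_image_le[OF finA, of row] by simp
  have "covering_array k n l (row ` A)"
    unfolding covering_array_def
  proof (intro conjI allI impI ballI)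
    show "row ` A \<subseteq> {1..k} \<rightarrow> {1..n}" using n by (auto simp: row_def)
  next
    fix S :: "nat set" and y
    assume S: "S \<subseteq> {1..k}" "card S = l" and y: "y \<in> S \<rightarrow> {1..n}"
    have "finite (int ` S)" using S(1) finite_subset by blast
    moreover have "coprime (u - v) (int m)" if "u \<in> int ` S" "v \<in> int ` S" "u \<noteq> v" for u v
      using that S(1) cop by blast
    ultimately obtain p :: "int poly" where p: "\<forall>i \<ge> card (int ` S). coeff p i = 0"
      "\<forall>u \<in> int ` S. [poly p u = int (y (nat u))] (mod int m)"
      using interpolation_mod[of "int ` S" "int m" "\<lambda>u. int (y (nat u))"] by blast
    have card_S: "card (int ` S) = l" using S(2) by (simp add: card_image)
    define a where "a = restrict (\<lambda>i. coeff p i mod int m) {..<l}"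
    have "a \<in> A" using n by (auto simp: a_def A_def)
    moreover have "row a c = y c" if c: "c \<in> S" for c
    proof -
      have yc: "y c \<in> {1..n}" using y c by auto
      have "poly p (int c) = (\<Sum>i<l. coeff p i * int c ^ i)"
      proof -
        have "poly p (int c) = (\<Sum>i\<le>degree p. coeff p i * int c ^ i)" by (rule poly_altdef)
        also have "\<dots> = (\<Sum>i\<in>{..degree p} \<inter> {..<l}. coeff p i * int c ^ i)"
          using p(1) card_S by (intro sum.mono_neutral_right) auto
        also have "\<dots> = (\<Sum>i<l. coeff p i * int c ^ i)"
          by (intro sum.mono_neutral_left) (auto simp: coeff_eq_0)
        finally show ?thesis .
      qed
      moreover have "[(\<Sum>i<l. a i * int c ^ i) = (\<Sum>i<l. coeff p i * int c ^ i)] (mod int m)"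
        by (intro cong_sum cong_mult cong_refl) (auto simp: a_def cong_def)
      moreover have "[poly p (int c) = int (y c)] (mod int m)" using p(2) c by auto
      ultimately have "[(\<Sum>i<l. a i * int c ^ i) = int (y c)] (mod int m)"
        by (metis cong_trans)
      moreover have "int (y c) mod int m = int (y c)" using yc n by simp
      ultimately have "val a c = y c" by (simp add: val_def cong_def)
      then show ?thesis using yc by (simp add: row_def)
    qed
    ultimately show "\<exists>r \<in> row ` A. \<forall>c \<in> S. r c = y c" by blast
  qed
  then show ?thesis using finA card by blast
qed

text \<open>Nonzero differences of points of \<open>{1..k}\<close> divide \<open>k!\<close>, and \<open>k!\<close> is coprime to every number that is \<open>1\<close>
  modulo \<open>k!\<close>.\<close>

lemma modulus_with_unit_differences:
  obtains m :: nat where "n < m" "m \<le> n + fact k + 1"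
    "\<And>x y. x \<in> {1..k} \<Longrightarrow> y \<in> {1..k} \<Longrightarrow> x \<noteq> y \<Longrightarrow> coprime (int x - int y) (int m)"
proof
  let ?m = "fact k * (n div fact k + 1) + 1 :: nat"
  have "n = fact k * (n div fact k) + n mod fact k" by simp
  moreover have "n mod fact k < fact k" by simp
  moreover have "fact k * (n div fact k + 1) = fact k * (n div fact k) + (fact k :: nat)"
    by (simp add: algebra_simps)
  ultimately show "n < ?m" "?m \<le> n + fact k + 1" by linarith+
  fix x y assume xy: "x \<in> {1..k}" "y \<in> {1..k}" "x \<noteq> y"
  have "nat \<bar>int x - int y\<bar> dvd fact k" using xy by (intro dvd_fact) auto
  then have "int x - int y dvd fact k"
    by (metis dvd_abs_iff abs_dvd_iff int_dvd_int_iff int_nat_eq abs_ge_zero of_nat_fact)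
  moreover have "coprime (fact k) (int ?m)"
  proof (rule coprimeI)
    fix c :: int assume "c dvd fact k" "c dvd int ?m"
    moreover have "int ?m = fact k * (int (n div fact k) + 1) + 1" by (simp add: algebra_simps)
    ultimately show "is_unit c" by (metis dvd_add_right_iff dvd_mult2)
  qed
  ultimately show "coprime (int x - int y) (int ?m)"
    using coprime_divisors dvd_refl by blast
qed

lemma shifted_power_le:
  fixes D :: real
  assumes "D \<ge> 0" "l \<ge> 1"
  shows "\<exists>C \<ge> 0. \<forall>x \<ge> 1. (x + D) ^ l \<le> x ^ l + C * x ^ (l - 1)"
  using assms(2)
proof (induction l rule: dec_induct)
  case base
  show ?case using assms by (intro exI[of _ D]) simp
next
  case (step l)
  then obtain C where C: "C \<ge> 0" "\<forall>x \<ge> 1. (x + D) ^ l \<le> x ^ l + C * x ^ (l - 1)" by blast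
  have "(x + D) ^ Suc l \<le> x ^ Suc l + (C + D + C * D) * x ^ (Suc l - 1)" if x: "x \<ge> 1" for x
  proof -
    obtain j where j: "l = Suc j" using step.hyps by (cases l) auto
    have "(x + D) ^ Suc l \<le> (x + D) * (x ^ l + C * x ^ (l - 1))"
      using C(2) x assms by (auto intro!: mult_left_mono)
    also have "\<dots> = x ^ Suc l + (C + D) * x ^ l + C * D * x ^ j"
      by (simp add: j algebra_simps)
    also have "\<dots> \<le> x ^ Suc l + (C + D) * x ^ l + C * D * x ^ l"
      using x C assms by (intro add_left_mono mult_left_mono power_increasing) (auto simp: j)
    finally show ?thesis by (simp add: algebra_simps)
  qed
  then show ?case using C(1) assms by (intro exI[of _ "C + D + C * D"]) auto
qed

theorem theorem13:
  fixes k l :: nat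
  assumes "1 \<le> l" and "l \<le> k"
  shows "\<exists>C::real. \<forall>n::nat. n \<ge> 1 \<longrightarrow>
           real (clique_cover_number k n l) \<le> real n ^ l + C * real n ^ (l - 1)"
proof -
  define D :: real where "D = fact k + 1"
  have "D \<ge> 0" by (simp add: D_def)
  from shifted_power_le[OF this assms(1)] obtain C where
    C: "\<forall>x \<ge> 1. (x + D) ^ l \<le> x ^ l + C * x ^ (l - 1)" by blast
  have "real (clique_cover_number k n l) \<le> real n ^ l + C * real n ^ (l - 1)" if n: "n \<ge> 1" for n
  proof -
    obtain m where m: "n < m" "m \<le> n + fact k + 1"
      "\<And>x y. x \<in> {1..k} \<Longrightarrow> y \<in> {1..k} \<Longrightarrow> x \<noteq> y \<Longrightarrow> coprime (int x - int y) (int m)"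
      using modulus_with_unit_differences by blast
    obtain R where R: "finite R" "covering_array k n l R" "card R \<le> m ^ l"
      using covering_array_exists[OF n m(1,3)] by blast
    have "clique_cover_number k n l \<le> m ^ l"
      using clique_cover_number_le_covering_array[OF R(2,1)] R(3) by simp
    then have "real (clique_cover_number k n l) \<le> real m ^ l"
      by (metis of_nat_le_iff of_nat_power)
    also have "real m \<le> real (n + fact k + 1)" using m(2) by (simp only: of_nat_le_iff)
    then have "real m ^ l \<le> (real n + D) ^ l" by (intro power_mono) (auto simp: D_def)
    also have "\<dots> \<le> real n ^ l + C * real n ^ (l - 1)" using C n by simp
    finally show ?thesis .
  qed
  then show ?thesis by blast
qed

end
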